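(* If $C$ is a difference set in a finite Abelian group $G$ with $-1$ as a multiplier, then the Cayley graph associated with $C$, or with one of the translates of $C$, is a Ramanujan graph.
   Context: Let $G$ be a finite Abelian group written multiplicatively with identity $1_G$. A subset $C\subseteq G$ with $|C|=k>1$ is a difference set with parameters $(|G|,k,\mu)$ if for every $g\neq 1_G$ in $G$ the number of pairs $(c_1,c_2)\in C\times C$ with $g=c_1c_2^{-1}$ equals $\mu$. The integer $t$ is a multiplier of $C$ if $\{c^t:c\in C\}$ is a translate $gC$ of $C$ for some $g\in G$. For a subset $C'$ of $G$ closed under inversion, the Cayley graph associated with $C'$ has vertex set $G$, and $u,v$ are adjacent if and only if $uv^{-1}\in C'$ (if $1_G\in C'$ each vertex has a loop, contributing $1$ to the diagonal of the adjacency matrix and to the valency). The eigenvalues of a graph are the eigenvalues of its adjacency matrix. A connected $k$-regular graph is called a Ramanujan graph if $\lambda\leq 2\sqrt{k-1}$ for all eigenvalues $\lambda$ of the graph with $|\lambda|\neq k$ (the first inequality is on $\lambda$ itself, as in the paper's definition). *)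

theory Defs
  imports
    "HOL-Algebra.Coset"
    "Graph_Theory.Graph_Theory"
    "Jordan_Normal_Form.Char_Poly"
begin

definition difference_set ::
    "('a, 'b) monoid_scheme \<Rightarrow> 'a set \<Rightarrow> nat \<Rightarrow> nat \<Rightarrow> nat \<Rightarrow> bool" where
  "difference_set G C v k \<mu> \<longleftrightarrow>
     card (carrier G) = v \<and> C \<subseteq> carrier G \<and> card C = k \<and> k > 1 \<and>
     (\<forall>g \<in> carrier G - {\<one>\<^bsub>G\<^esub>}.
        card {(c1, c2) \<in> C \<times> C. g = c1 \<otimes>\<^bsub>G\<^esub> inv\<^bsub>G\<^esub> c2} = \<mu>)"

definition is_multiplier :: "('a, 'b) monoid_scheme \<Rightarrow> 'a set \<Rightarrow> int \<Rightarrow> bool" where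
  "is_multiplier G C t \<longleftrightarrow>
     (\<exists>g \<in> carrier G. (\<lambda>c. c [^]\<^bsub>G\<^esub> t) ` C = g <#\<^bsub>G\<^esub> C)"

definition inverse_closed :: "('a, 'b) monoid_scheme \<Rightarrow> 'a set \<Rightarrow> bool" where
  "inverse_closed G S \<longleftrightarrow> S \<subseteq> carrier G \<and> (\<forall>s \<in> S. inv\<^bsub>G\<^esub> s \<in> S)"

text \<open>
  An undirected graph, possibly with loops but without parallel edges, is a symmetric set of
  arcs; each loop is a single arc, so it contributes one to the valency of its vertex and one
  to the diagonal of the adjacency matrix.  The relation below is symmetric exactly when
  \<open>S \<inter> carrier G\<close> is closed under inversion.
\<close>

definition cayley_graph :: "('a, 'b) monoid_scheme \<Rightarrow> 'a set \<Rightarrow> 'a pair_pre_digraph" where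
  "cayley_graph G S =
     \<lparr> pverts = carrier G,
       parcs = {(u, v) \<in> carrier G \<times> carrier G. u \<otimes>\<^bsub>G\<^esub> inv\<^bsub>G\<^esub> v \<in> S} \<rparr>"

text \<open>
  Matrices are indexed by natural numbers, so the adjacency matrix is taken with respect to
  an enumeration \<open>vs\<close> of the vertices.  Different enumerations give matrices that are conjugate
  by a permutation matrix, hence the eigenvalues do not depend on \<open>vs\<close>.  The matrix is real
  symmetric, so nothing is lost by considering only real eigenvalues.
\<close>

definition adjacency_matrix :: "'a pair_pre_digraph \<Rightarrow> 'a list \<Rightarrow> real mat" where
  "adjacency_matrix H vs =
     mat (length vs) (length vs) (\<lambda>(i, j). if (vs ! i, vs ! j) \<in> parcs H then 1 else 0)"

definition graph_eigenvalue :: "'a pair_pre_digraph \<Rightarrow> real \<Rightarrow> bool" where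
  "graph_eigenvalue H \<theta> \<longleftrightarrow>
     (\<exists>vs. distinct vs \<and> set vs = pverts H \<and> eigenvalue (adjacency_matrix H vs) \<theta>)"

definition regular_graph :: "'a pair_pre_digraph \<Rightarrow> nat \<Rightarrow> bool" where
  "regular_graph H k \<longleftrightarrow> (\<forall>u \<in> pverts H. out_degree (with_proj H) u = k)"

text \<open>
  The bound is imposed on the eigenvalue itself, not on its absolute value.
\<close>

definition ramanujan_graph :: "'a pair_pre_digraph \<Rightarrow> bool" where
  "ramanujan_graph H \<longleftrightarrow>
     pair_pseudo_graph H \<and> Digraph_Component.connected (with_proj H) \<and>
     (\<exists>k. regular_graph H k \<and>
        (\<forall>\<theta>. graph_eigenvalue H \<theta> \<and> \<bar>\<theta>\<bar> \<noteq> real k \<longrightarrow> \<theta> \<le> 2 * sqrt (real k - 1)))"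

end

theory Submission
  imports Defs
begin

text \<open>
  Inversion is an automorphism of the symmetric design formed by the translates of \<open>C\<close>, so
  by counting flags it fixes as many translates as points (if \<open>k = \<mu>\<close> the design degenerates,
  but then all translates of \<open>C\<close> coincide).  Since it fixes the point \<open>1\<close>, some translate
  equals its own inverse.  The adjacency matrix of the Cayley graph of this translate satisfies
  \<open>A\<^sup>2 = (k - \<mu>) I + \<mu> J\<close>, so every eigenvalue other than \<open>k\<close> squares to \<open>k - \<mu>\<close>, which is
  less than \<open>4 (k - 1)\<close>.
\<close>

text \<open>The coefficient of \<open>y\<close> in the group-ring product of \<open>C\<close> with
  its inverse. It is kept apart from \<open>\<mu>\<close> because it also makes sense at the
  identity, where it is \<open>card C\<close>, so the counts below need no case split on whether two
  points or translates coincide.\<close>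

definition diff_count :: "('a, 'b) monoid_scheme \<Rightarrow> 'a set \<Rightarrow> 'a \<Rightarrow> nat" where
  "diff_count G C y = card {(c1, c2) \<in> C \<times> C. y = c1 \<otimes>\<^bsub>G\<^esub> inv\<^bsub>G\<^esub> c2}"

section \<open>Translates of \<open>C\<close> and their incidence counts\<close>

context comm_group
begin

lemma mem_l_coset_iff:
  assumes "C \<subseteq> carrier G" "a \<in> carrier G" "x \<in> carrier G"
  shows "x \<in> a <# C \<longleftrightarrow> inv a \<otimes> x \<in> C"
proof
  assume "x \<in> a <# C"
  then obtain c where "c \<in> C" "x = a \<otimes> c"
    by (auto simp: l_coset_def)
  then show "inv a \<otimes> x \<in> C"
    using assms by (auto simp: m_assoc [symmetric])
next
  assume "inv a \<otimes> x \<in> C"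
  moreover have "x = a \<otimes> (inv a \<otimes> x)"
    using assms by (simp add: m_assoc [symmetric])
  ultimately show "x \<in> a <# C"
    unfolding l_coset_def by blast
qed

lemma card_l_coset:
  assumes "C \<subseteq> carrier G" "a \<in> carrier G"
  shows "card (a <# C) = card C"
proof -
  have "a <# C = (\<lambda>c. a \<otimes> c) ` C"
    by (auto simp: l_coset_def)
  moreover have "inj_on (\<lambda>c. a \<otimes> c) C"
    using assms inj_on_cmult inj_on_subset by blast
  ultimately show ?thesis
    by (simp add: card_image)
qed

lemma mult_inv_mult_cancel_left:
  assumes "a \<in> carrier G" "x \<in> carrier G" "y \<in> carrier G"
  shows "a \<otimes> x \<otimes> inv (a \<otimes> y) = x \<otimes> inv y"
proof -
  have "a \<otimes> x \<otimes> inv (a \<otimes> y) = x \<otimes> a \<otimes> (inv a \<otimes> inv y)"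
    using assms by (simp add: inv_mult m_comm [of a x])
  moreover have "a \<otimes> (inv a \<otimes> inv y) = inv y"
    using assms by (simp add: m_assoc [symmetric])
  ultimately show ?thesis
    using assms by (simp add: m_assoc)
qed

text \<open>A translate by \<open>a\<close> through \<open>x\<close> and \<open>y\<close> yields the
  pair \<open>(inv a \<otimes> x, inv a \<otimes> y)\<close> in \<open>C\<close>, whose quotient
  does not depend on \<open>a\<close>. Conversely \<open>c1\<close> recovers
  \<open>a = x \<otimes> inv c1\<close>, and the prescribed quotient then forces \<open>c2\<close>,
  which is why \<open>?g\<close> ignores it.\<close>

lemma card_translates_containing_two_points:
  assumes C: "C \<subseteq> carrier G" and x: "x \<in> carrier G" and y: "y \<in> carrier G"
  shows "card {a \<in> carrier G. inv a \<otimes> x \<in> C \<and> inv a \<otimes> y \<in> C} = diff_count G C (x \<otimes> inv y)"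
  unfolding diff_count_def
proof (rule bij_betw_same_card, rule bij_betw_byWitness)
  let ?f = "\<lambda>a. (inv a \<otimes> x, inv a \<otimes> y)" and ?g = "\<lambda>(c1, c2). x \<otimes> inv c1"
  let ?A = "{a \<in> carrier G. inv a \<otimes> x \<in> C \<and> inv a \<otimes> y \<in> C}"
  let ?P = "{(c1, c2) \<in> C \<times> C. x \<otimes> inv y = c1 \<otimes> inv c2}"
  show "\<forall>a\<in>?A. ?g (?f a) = a"
    using x by (simp add: inv_mult m_ac)
  have *: "inv (x \<otimes> inv c1) \<otimes> x = c1" if "c1 \<in> carrier G" for c1
    using x that by (simp add: inv_mult_group m_assoc)
  have **: "inv (x \<otimes> inv c1) \<otimes> y = c2"
    if "c1 \<in> carrier G" "c2 \<in> carrier G" "x \<otimes> inv y = c1 \<otimes> inv c2" for c1 c2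
  proof -
    have "inv (x \<otimes> inv c1) \<otimes> y = c1 \<otimes> inv (x \<otimes> inv y)"
      using x y that(1) by (simp add: inv_mult_group m_ac)
    also have "\<dots> = c1 \<otimes> (c2 \<otimes> inv c1)"
      using that by (simp add: inv_mult_group)
    also have "\<dots> = c2"
      using that by (simp add: m_lcomm [of c1])
    finally show ?thesis .
  qed
  show "\<forall>p\<in>?P. ?f (?g p) = p"
    using C * ** by (auto simp: subset_iff)
  show "?f ` ?A \<subseteq> ?P"
    using x y by (auto simp: mult_inv_mult_cancel_left)
  show "?g ` ?P \<subseteq> ?A"
  proof (rule image_subsetI)
    fix p assume "p \<in> ?P"
    then obtain c1 c2 where p: "p = (c1, c2)" "c1 \<in> C" "c2 \<in> C" "x \<otimes> inv y = c1 \<otimes> inv c2"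
      by blast
    moreover have "c1 \<in> carrier G" "c2 \<in> carrier G"
      using p C by auto
    ultimately show "?g p \<in> ?A"
      using x * [of c1] ** [of c1 c2] by simp
  qed
qed

text \<open>The dual count, with points and translates exchanged: a common point \<open>x\<close> of
  the translates by \<open>a\<close> and \<open>b\<close> yields a pair in \<open>C\<close> whose
  quotient is free of \<open>x\<close>, and \<open>x = a \<otimes> c1\<close> is recovered from that
  pair.\<close>

lemma card_common_points_of_translates:
  assumes C: "C \<subseteq> carrier G" and a: "a \<in> carrier G" and b: "b \<in> carrier G"
  shows "card {x \<in> carrier G. inv a \<otimes> x \<in> C \<and> inv b \<otimes> x \<in> C} = diff_count G C (inv a \<otimes> b)"
  unfolding diff_count_def
proof (rule bij_betw_same_card, rule bij_betw_byWitness)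
  let ?f = "\<lambda>x. (inv a \<otimes> x, inv b \<otimes> x)" and ?g = "\<lambda>(c1, c2). a \<otimes> c1"
  let ?A = "{x \<in> carrier G. inv a \<otimes> x \<in> C \<and> inv b \<otimes> x \<in> C}"
  let ?P = "{(c1, c2) \<in> C \<times> C. inv a \<otimes> b = c1 \<otimes> inv c2}"
  show "\<forall>x\<in>?A. ?g (?f x) = x"
    using a by (simp add: m_assoc [symmetric])
  have *: "inv a \<otimes> (a \<otimes> c1) = c1" if "c1 \<in> carrier G" for c1
    using a that by (simp add: m_assoc [symmetric])
  have **: "inv b \<otimes> (a \<otimes> c1) = c2"
    if "c1 \<in> carrier G" "c2 \<in> carrier G" "inv a \<otimes> b = c1 \<otimes> inv c2" for c1 c2
  proof -
    have "inv b \<otimes> (a \<otimes> c1) = c1 \<otimes> inv (inv a \<otimes> b)"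
      using a b that(1) by (simp add: inv_mult_group m_ac)
    also have "\<dots> = c1 \<otimes> (c2 \<otimes> inv c1)"
      using that by (simp add: inv_mult_group)
    also have "\<dots> = c2"
      using that by (simp add: m_lcomm [of c1])
    finally show ?thesis .
  qed
  show "\<forall>p\<in>?P. ?f (?g p) = p"
    using C * ** by (auto simp: subset_iff)
  show "?f ` ?A \<subseteq> ?P"
  proof (rule image_subsetI)
    fix x assume "x \<in> ?A"
    then show "?f x \<in> ?P"
      using a b mult_inv_mult_cancel_left [of x "inv a" "inv b"] by (simp add: m_comm [of x])
  qed
  show "?g ` ?P \<subseteq> ?A"
  proof (rule image_subsetI)
    fix p assume "p \<in> ?P"
    then obtain c1 c2 where p: "p = (c1, c2)" "c1 \<in> C" "c2 \<in> C" "inv a \<otimes> b = c1 \<otimes> inv c2"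
      by blast
    moreover have "c1 \<in> carrier G" "c2 \<in> carrier G"
      using p C by auto
    ultimately show "?g p \<in> ?A"
      using a * [of c1] ** [of c1 c2] by simp
  qed
qed

lemma diff_count_one:
  assumes "C \<subseteq> carrier G"
  shows "diff_count G C \<one> = card C"
proof -
  have "{(c1, c2) \<in> C \<times> C. \<one> = c1 \<otimes> inv c2} = (\<lambda>c. (c, c)) ` C"
  proof -
    have "\<one> = c1 \<otimes> inv c2 \<longleftrightarrow> c1 = c2" if "c1 \<in> C" "c2 \<in> C" for c1 c2
      using assms that by (metis inv_closed inv_equality inv_inv r_inv subsetD)
    then show ?thesis
      by auto
  qed
  then show ?thesis
    by (simp add: diff_count_def card_image inj_on_def)
qed

lemma diff_count_le:
  assumes "finite (carrier G)" "C \<subseteq> carrier G" "y \<in> carrier G"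
  shows "diff_count G C y \<le> card C"
proof -
  \<comment> \<open>Taking \<open>a = \<one>\<close> makes \<open>C\<close> itself one of the two
    translates, so the count is the size of a subset of \<open>C\<close>.\<close>
  have "diff_count G C y = card {x \<in> carrier G. x \<in> C \<and> inv y \<otimes> x \<in> C}"
    using card_common_points_of_translates [OF assms(2), of \<one> y] assms(3)
    by (simp cong: conj_cong)
  also have "\<dots> \<le> card C"
    using assms by (intro card_mono) (auto intro: finite_subset)
  finally show ?thesis .
qed

text \<open>Two finite sets of equal size that share that many elements coincide. The conclusion
  equates translates rather than \<open>a\<close> and \<open>b\<close>, so that it also serves the
  degenerate case \<open>k = \<mu>\<close>.\<close>

lemma l_cosets_eq_if_diff_count_eq_card:
  assumes "finite (carrier G)" "C \<subseteq> carrier G" "a \<in> carrier G" "b \<in> carrier G"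
    and "diff_count G C (inv a \<otimes> b) = card C"
  shows "a <# C = b <# C"
proof -
  have sub: "a <# C \<subseteq> carrier G" "b <# C \<subseteq> carrier G"
    using assms l_coset_subset_G by auto
  then have fin: "finite (a <# C)" "finite (b <# C)"
    using assms(1) finite_subset by auto
  have "{x \<in> carrier G. inv a \<otimes> x \<in> C \<and> inv b \<otimes> x \<in> C} = (a <# C) \<inter> (b <# C)"
    using sub assms mem_l_coset_iff by blast
  then have eq: "card ((a <# C) \<inter> (b <# C)) = card C"
    using card_common_points_of_translates [OF assms(2-4)] assms(5) by simp
  have "(a <# C) \<inter> (b <# C) = a <# C" "(a <# C) \<inter> (b <# C) = b <# C"
    using card_subset_eq [OF fin(1) Int_lower1] card_subset_eq [OF fin(2) Int_lower2]
      eq assms(2-4) card_l_coset by auto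
  then show ?thesis
    by simp
qed

text \<open>A common factor \<open>a\<close> cancels in every quotient. The proof reads this off the
  intersection of the translates of \<open>C\<close> by \<open>a\<close> and by
  \<open>y \<otimes> a\<close>.\<close>

lemma difference_set_l_coset:
  assumes C: "difference_set G C v k \<mu>" and a: "a \<in> carrier G"
  shows "difference_set G (a <# C) v k \<mu>"
proof -
  have sub: "C \<subseteq> carrier G"
    using C by (simp add: difference_set_def)
  have "diff_count G (a <# C) y = diff_count G C y" if y: "y \<in> carrier G" for y
  proof -
    have sub': "a <# C \<subseteq> carrier G"
      using sub a l_coset_subset_G by auto
    have "diff_count G (a <# C) y
        = card {x \<in> carrier G. x \<in> a <# C \<and> inv y \<otimes> x \<in> a <# C}"
      using card_common_points_of_translates [OF sub', of \<one> y] y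
      by (simp cong: conj_cong)
    also have "{x \<in> carrier G. x \<in> a <# C \<and> inv y \<otimes> x \<in> a <# C}
        = {x \<in> carrier G. inv a \<otimes> x \<in> C \<and> inv (y \<otimes> a) \<otimes> x \<in> C}"
      using sub a y by (auto simp: mem_l_coset_iff inv_mult_group m_assoc)
    also have "card \<dots> = diff_count G C (inv a \<otimes> (y \<otimes> a))"
      using sub a y by (simp add: card_common_points_of_translates)
    also have "inv a \<otimes> (y \<otimes> a) = y"
      using a y by (simp add: m_lcomm [of _ y])
    finally show ?thesis .
  qed
  then show ?thesis
    using C a sub card_l_coset l_coset_subset_G
    by (auto simp: difference_set_def diff_count_def)
qed

section \<open>A translate closed under inversion\<close>

lemma difference_set_diff_count:
  assumes "difference_set G C v k \<mu>" "y \<in> carrier G" "y \<noteq> \<one>"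
  shows "diff_count G C y = \<mu>"
  using assms by (simp add: difference_set_def diff_count_def)

text \<open>Double counting of the pairs \<open>(a, x)\<close> for which the translate by
  \<open>a\<close> contains both \<open>x\<close> and \<open>inv x\<close>. Fixing \<open>x\<close>
  counts translates through two points with quotient \<open>x \<otimes> x\<close>; fixing
  \<open>a\<close> counts common points of that translate and its inverse, which is the translate by
  \<open>inv a \<otimes> g\<close>.\<close>

lemma sum_diff_count_squares:
  assumes fin: "finite (carrier G)" and C: "C \<subseteq> carrier G" and g: "g \<in> carrier G"
    and inv: "(\<lambda>c. inv c) ` C = g <# C"
  shows "(\<Sum>x\<in>carrier G. diff_count G C (x \<otimes> x))
       = (\<Sum>a\<in>carrier G. diff_count G C (inv a \<otimes> (inv a \<otimes> g)))"
proof -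
  have inv_mem: "inv c \<in> C \<longleftrightarrow> inv g \<otimes> c \<in> C" if "c \<in> carrier G" for c
  proof -
    have "inv c \<in> C \<longleftrightarrow> c \<in> (\<lambda>c. inv c) ` C"
      using that C by (metis (no_types, lifting) image_iff inv_inv subsetD)
    then show ?thesis
      using that C g by (simp add: inv mem_l_coset_iff)
  qed
  let ?I = "\<lambda>a x. inv a \<otimes> x \<in> C \<and> inv a \<otimes> inv x \<in> C"
  have "(\<Sum>x\<in>carrier G. diff_count G C (x \<otimes> x)) = (\<Sum>x\<in>carrier G. card {a \<in> carrier G. ?I a x})"
    using C by (intro sum.cong) (simp_all add: card_translates_containing_two_points)
  also have "\<dots> = (\<Sum>x\<in>carrier G. \<Sum>a\<in>carrier G. if ?I a x then 1 else 0)"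
    using fin by (simp add: sum.If_cases Int_def)
  also have "\<dots> = (\<Sum>a\<in>carrier G. \<Sum>x\<in>carrier G. if ?I a x then 1 else 0)"
    by (rule sum.swap)
  also have "\<dots> = (\<Sum>a\<in>carrier G. card {x \<in> carrier G. ?I a x})"
    using fin by (simp add: sum.If_cases Int_def)
  also have "\<dots> = (\<Sum>a\<in>carrier G. diff_count G C (inv a \<otimes> (inv a \<otimes> g)))"
  proof (rule sum.cong [OF refl])
    fix a assume a: "a \<in> carrier G"
    \<comment> \<open>Inversion sends the translate by \<open>a\<close> to the translate by
      \<open>inv a \<otimes> g\<close>, because it sends \<open>C\<close> to
      \<open>g <# C\<close>.\<close>
    have "inv a \<otimes> inv x \<in> C \<longleftrightarrow> inv (inv a \<otimes> g) \<otimes> x \<in> C" if x: "x \<in> carrier G" for x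
    proof -
      have "inv a \<otimes> inv x = inv (a \<otimes> x)"
        using a x by (simp add: inv_mult)
      moreover have "inv g \<otimes> (a \<otimes> x) = inv (inv a \<otimes> g) \<otimes> x"
        using a g x by (simp add: inv_mult_group m_assoc)
      ultimately show ?thesis
        using inv_mem [of "a \<otimes> x"] a x by simp
    qed
    then have "{x \<in> carrier G. ?I a x}
        = {x \<in> carrier G. inv a \<otimes> x \<in> C \<and> inv (inv a \<otimes> g) \<otimes> x \<in> C}"
      by blast
    then show "card {x \<in> carrier G. ?I a x} = diff_count G C (inv a \<otimes> (inv a \<otimes> g))"
      using C a g by (simp add: card_common_points_of_translates)
  qed
  finally show ?thesis .
qed

text \<open>The translate by \<open>a\<close> is its own inverse once it meets the translate by
  \<open>inv a \<otimes> g\<close> in \<open>k\<close> points. If this happened for no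
  \<open>a\<close>, the two sides of the double count would differ.\<close>

lemma ex_inverse_closed_l_coset:
  assumes fin: "finite (carrier G)" and D: "difference_set G C v k \<mu>"
    and mult: "is_multiplier G C (- 1)"
  shows "\<exists>a \<in> carrier G. inverse_closed G (a <# C)"
proof -
  have C: "C \<subseteq> carrier G" and k: "card C = k"
    using D by (auto simp: difference_set_def)
  obtain g where g: "g \<in> carrier G" and "(\<lambda>c. c [^] (- 1 :: int)) ` C = g <# C"
    using mult by (auto simp: is_multiplier_def)
  moreover have "c [^] (- 1 :: int) = inv c" if "c \<in> C" for c
    using that C int_pow_neg [of c 1] int_pow_1 [of c] by auto
  ultimately have inv: "(\<lambda>c. inv c) ` C = g <# C"
    by (metis (no_types, lifting) image_cong)
  have "\<exists>a\<in>carrier G. diff_count G C (inv a \<otimes> (inv a \<otimes> g)) = k"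
  proof (rule ccontr)
    assume contra: "\<not> ?thesis"
    \<comment> \<open>The count at the identity is \<open>k\<close>, so a count different from
      \<open>k\<close> is taken at a non-identity element and equals \<open>\<mu>\<close>.\<close>
    have \<mu>: "diff_count G C (inv a \<otimes> (inv a \<otimes> g)) = \<mu>" if "a \<in> carrier G" for a
      using contra that g C k difference_set_diff_count [OF D] diff_count_one
      by (metis inv_closed m_closed)
    have "\<mu> \<noteq> k"
      using contra \<mu> by blast
    moreover have "\<mu> \<le> k"
      using \<mu> [of \<one>] diff_count_le [OF fin C] g k by force
    ultimately have "\<mu> < k"
      by simp
    \<comment> \<open>Every term is \<open>k\<close> or \<open>\<mu>\<close>, according to whether
      \<open>x \<otimes> x\<close> is the identity, and the fixed point \<open>x = \<one>\<close> of
      inversion contributes \<open>k > \<mu>\<close>. The other side of the double count has all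
      terms equal to \<open>\<mu>\<close>.\<close>
    have "(\<Sum>x\<in>carrier G. \<mu>) < (\<Sum>x\<in>carrier G. diff_count G C (x \<otimes> x))"
    proof (rule sum_strict_mono_ex1 [OF fin])
      show "\<forall>x\<in>carrier G. \<mu> \<le> diff_count G C (x \<otimes> x)"
        using difference_set_diff_count [OF D] diff_count_one [OF C] k \<open>\<mu> \<le> k\<close>
        by (metis le_refl m_closed)
      show "\<exists>x\<in>carrier G. \<mu> < diff_count G C (x \<otimes> x)"
        using diff_count_one [OF C] k \<open>\<mu> < k\<close> by (intro bexI [of _ \<one>]) auto
    qed
    then show False
      using sum_diff_count_squares [OF fin C g inv] \<mu> by simp
  qed
  then obtain a where a: "a \<in> carrier G" and "diff_count G C (inv a \<otimes> (inv a \<otimes> g)) = k"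
    by blast
  then have eq: "a <# C = (inv a \<otimes> g) <# C"
    using l_cosets_eq_if_diff_count_eq_card [OF fin C a] g k by simp
  have "inv s \<in> a <# C" if s: "s \<in> a <# C" for s
  proof -
    obtain c where c: "c \<in> C" "s = a \<otimes> c"
      using s by (auto simp: l_coset_def)
    then have "inv c \<in> g <# C"
      using inv by blast
    then obtain d where d: "d \<in> C" "inv c = g \<otimes> d"
      by (auto simp: l_coset_def)
    have "inv s = inv a \<otimes> g \<otimes> d"
      using c d a g C by (auto simp: inv_mult m_assoc subset_iff)
    then show ?thesis
      unfolding eq using d by (auto simp: l_coset_def)
  qed
  then show ?thesis
    using a C l_coset_subset_G unfolding inverse_closed_def by blast
qed

section \<open>Neighbourhoods and spectrum of the Cayley graph\<close>

lemma inverse_closed_swap: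
  assumes "inverse_closed G D" "u \<in> carrier G" "w \<in> carrier G" "u \<otimes> inv w \<in> D"
  shows "w \<otimes> inv u \<in> D"
proof -
  have "inv (u \<otimes> inv w) \<in> D"
    using assms unfolding inverse_closed_def by blast
  then show ?thesis
    using assms by (simp add: inv_mult_group)
qed

lemma card_cayley_out_neighbours:
  assumes D: "D \<subseteq> carrier G" and u: "u \<in> carrier G"
  shows "card {w \<in> carrier G. u \<otimes> inv w \<in> D} = card D"
proof -
  \<comment> \<open>A neighbour \<open>w\<close> of \<open>u\<close> is the same as a translate of
    \<open>D\<close> by \<open>w\<close> that contains \<open>u\<close>. The condition is doubled to
    make it the two-point count with both points equal to \<open>u\<close>, which is the count at
    the identity.\<close>
  have "{w \<in> carrier G. u \<otimes> inv w \<in> D} = {a \<in> carrier G. inv a \<otimes> u \<in> D \<and> inv a \<otimes> u \<in> D}"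
    using u by (auto simp: m_comm)
  then show ?thesis
    using card_translates_containing_two_points [OF D u u] diff_count_one [OF D] u by simp
qed

lemma card_cayley_common_out_neighbours:
  assumes D: "D \<subseteq> carrier G" and u: "u \<in> carrier G" and w: "w \<in> carrier G"
  shows "card {x \<in> carrier G. u \<otimes> inv x \<in> D \<and> w \<otimes> inv x \<in> D} = diff_count G D (u \<otimes> inv w)"
proof -
  have "{x \<in> carrier G. u \<otimes> inv x \<in> D \<and> w \<otimes> inv x \<in> D}
      = {a \<in> carrier G. inv a \<otimes> u \<in> D \<and> inv a \<otimes> w \<in> D}"
    using u w by (auto simp: m_comm)
  then show ?thesis
    using card_translates_containing_two_points [OF D u w] by simp
qed

text \<open>Eigenvectors are treated as functions on the group, so that sums run over
  \<open>carrier G\<close> without an enumeration. An eigenfunction for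
  \<open>\<theta> \<noteq> k\<close> sums to zero, so the all-ones part of the squared adjacency
  operator annihilates it and only the scalar \<open>k - \<mu>\<close> is left.\<close>

lemma cayley_eigenfunction_square:
  fixes f :: "'a \<Rightarrow> real"
  assumes fin: "finite (carrier G)" and D: "difference_set G D v k \<mu>"
    and inv: "inverse_closed G D"
    and f: "\<And>u. u \<in> carrier G \<Longrightarrow>
      (\<Sum>w\<in>carrier G. (if u \<otimes> inv w \<in> D then 1 else 0) * f w) = \<theta> * f u"
    and u: "u \<in> carrier G" "f u \<noteq> 0" and \<theta>: "\<theta> \<noteq> real k"
  shows "\<theta>\<^sup>2 = real k - real \<mu>"
proof -
  define B :: "'a \<Rightarrow> 'a \<Rightarrow> real" where "B x y = (if x \<otimes> inv y \<in> D then 1 else 0)" for x y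
  have sub: "D \<subseteq> carrier G" and k: "card D = k"
    using D by (auto simp: difference_set_def)
  have sym: "B x y = B y x" if "x \<in> carrier G" "y \<in> carrier G" for x y
    using that inverse_closed_swap [OF inv] unfolding B_def by metis
  have fB: "(\<Sum>w\<in>carrier G. B x w * f w) = \<theta> * f x" if "x \<in> carrier G" for x
    using f that by (simp add: B_def)
  have row: "(\<Sum>w\<in>carrier G. B x w) = real k" if "x \<in> carrier G" for x
    using card_cayley_out_neighbours [OF sub that] fin k
    by (simp add: B_def sum.If_cases Int_def)
  \<comment> \<open>By symmetry of \<open>B\<close>, walks of length two from \<open>u\<close> to
    \<open>w\<close> correspond to common out-neighbours, which number \<open>k\<close> if
    \<open>u = w\<close> and \<open>\<mu>\<close> otherwise.\<close>
  have square: "(\<Sum>x\<in>carrier G. B u x * B x w)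
      = real \<mu> + (if u = w then real k - real \<mu> else 0)" if w: "w \<in> carrier G" for w
  proof -
    have "(\<Sum>x\<in>carrier G. B u x * B x w)
        = (\<Sum>x\<in>carrier G. if u \<otimes> inv x \<in> D \<and> w \<otimes> inv x \<in> D then 1 else 0)"
      using sym [OF _ w] by (intro sum.cong) (auto simp: B_def)
    also have "\<dots> = real (diff_count G D (u \<otimes> inv w))"
      using card_cayley_common_out_neighbours [OF sub u(1) w] fin
      by (simp add: sum.If_cases Int_def)
    also have "\<dots> = real \<mu> + (if u = w then real k - real \<mu> else 0)"
    proof (cases "u = w")
      case True
      then show ?thesis
        using diff_count_one [OF sub] k w by simp
    next
      case False
      then have "u \<otimes> inv w \<noteq> \<one>"
        using u w by (metis inv_closed inv_equality inv_inv)
      then show ?thesis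
        using False difference_set_diff_count [OF D] u w by simp
    qed
    finally show ?thesis .
  qed
  \<comment> \<open>Symmetry turns the row sums \<open>k\<close> into column sums, so summing the
    eigenvalue equation over all vertices gives \<open>\<theta>\<close> times the total equal to
    \<open>k\<close> times the total.\<close>
  have "\<theta> * (\<Sum>x\<in>carrier G. f x) = (\<Sum>x\<in>carrier G. \<Sum>w\<in>carrier G. B x w * f w)"
    using fB by (simp add: sum_distrib_left)
  also have "\<dots> = (\<Sum>w\<in>carrier G. \<Sum>x\<in>carrier G. B x w * f w)"
    by (rule sum.swap)
  also have "\<dots> = (\<Sum>w\<in>carrier G. (\<Sum>x\<in>carrier G. B w x) * f w)"
    by (intro sum.cong refl) (simp add: sum_distrib_right sym)
  also have "\<dots> = real k * (\<Sum>w\<in>carrier G. f w)"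
    by (simp add: row sum_distrib_left)
  finally have sum0: "(\<Sum>x\<in>carrier G. f x) = 0"
    using \<theta> by simp
  \<comment> \<open>The eigenvalue equation is applied twice at the vertex \<open>u\<close>, where
    \<open>f\<close> does not vanish.\<close>
  have "\<theta> * \<theta> * f u = (\<Sum>x\<in>carrier G. B u x * (\<theta> * f x))"
    using fB [OF u(1)] by (simp add: sum_distrib_left [symmetric] mult.left_commute mult.assoc)
  also have "\<dots> = (\<Sum>x\<in>carrier G. \<Sum>w\<in>carrier G. B u x * B x w * f w)"
    by (simp add: fB [symmetric] sum_distrib_left mult.assoc)
  also have "\<dots> = (\<Sum>w\<in>carrier G. \<Sum>x\<in>carrier G. B u x * B x w * f w)"
    by (rule sum.swap)
  also have "\<dots> = (\<Sum>w\<in>carrier G. (\<Sum>x\<in>carrier G. B u x * B x w) * f w)"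
    by (simp add: sum_distrib_right)
  also have "\<dots> = (\<Sum>w\<in>carrier G. real \<mu> * f w + (if u = w then (real k - real \<mu>) * f w else 0))"
    by (intro sum.cong refl) (simp add: square distrib_right)
  also have "\<dots> = real \<mu> * (\<Sum>w\<in>carrier G. f w) + (real k - real \<mu>) * f u"
    using fin u by (simp add: sum.distrib sum_distrib_left)
  finally show ?thesis
    using sum0 u by (simp add: power2_eq_square)
qed

end

section \<open>From matrix eigenvectors to functions on vertices\<close>

lemma cayley_graph_simps [simp]:
  "pverts (cayley_graph G S) = carrier G"
  "parcs (cayley_graph G S) = {(u, w) \<in> carrier G \<times> carrier G. u \<otimes>\<^bsub>G\<^esub> inv\<^bsub>G\<^esub> w \<in> S}"
  by (simp_all add: cayley_graph_def)

lemma graph_eigenvalue_eigenfunction: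
  assumes "graph_eigenvalue H \<theta>"
  obtains u and f :: "'a \<Rightarrow> real" where "u \<in> pverts H" "f u \<noteq> 0"
    and "\<And>x. x \<in> pverts H \<Longrightarrow>
      (\<Sum>w\<in>pverts H. (if (x, w) \<in> parcs H then 1 else 0) * f w) = \<theta> * f x"
proof -
  obtain vs where vs: "distinct vs" "set vs = pverts H"
    and "eigenvalue (adjacency_matrix H vs) \<theta>"
    using assms by (auto simp: graph_eigenvalue_def)
  then obtain y where "eigenvector (adjacency_matrix H vs) y \<theta>"
    by (auto simp: eigenvalue_def)
  then have y: "y \<in> carrier_vec (length vs)" "y \<noteq> 0\<^sub>v (length vs)"
    and eig: "adjacency_matrix H vs *\<^sub>v y = \<theta> \<cdot>\<^sub>v y"
    by (auto simp: eigenvector_def adjacency_matrix_def)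
  have bij: "bij_betw ((!) vs) {..<length vs} (pverts H)"
    using bij_betw_nth [OF vs(1)] vs(2) by blast
  \<comment> \<open>The value at a vertex is the coordinate of \<open>y\<close> at its position in
    \<open>vs\<close>; that position is unique because \<open>vs\<close> is distinct. Values off the
    vertex set are arbitrary and never enter the sums.\<close>
  define f where "f x = y $ inv_into {..<length vs} ((!) vs) x" for x
  have f_nth: "f (vs ! i) = y $ i" if "i < length vs" for i
    using that bij by (simp add: f_def bij_betw_def)
  obtain i where i: "i < length vs" "y $ i \<noteq> 0"
    using y by (metis carrier_vecD eq_vecI index_zero_vec)
  show thesis
  proof (rule that [of "vs ! i" f])
    show "vs ! i \<in> pverts H" "f (vs ! i) \<noteq> 0"
      using i vs f_nth nth_mem by auto
    fix x assume "x \<in> pverts H"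
    then obtain j where j: "j < length vs" "x = vs ! j"
      using vs by (metis in_set_conv_nth)
    have "(\<Sum>w\<in>pverts H. (if (x, w) \<in> parcs H then 1 else 0) * f w)
        = (\<Sum>l<length vs. (if (vs ! j, vs ! l) \<in> parcs H then 1 else 0) * f (vs ! l))"
      unfolding j(2) by (rule sum.reindex_bij_betw [OF bij, symmetric])
    also have "\<dots> = (adjacency_matrix H vs *\<^sub>v y) $ j"
      using j y
      by (simp add: adjacency_matrix_def scalar_prod_def f_nth lessThan_atLeast0)
    also have "\<dots> = \<theta> * f x"
      using eig j y f_nth by simp
    finally show "(\<Sum>w\<in>pverts H. (if (x, w) \<in> parcs H then 1 else 0) * f w) = \<theta> * f x" .
  qed
qed

section \<open>The Ramanujan property\<close>

context comm_group
begin

lemma pair_pseudo_graph_cayley_graph: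
  assumes "finite (carrier G)" "inverse_closed G D"
  shows "pair_pseudo_graph (cayley_graph G D)"
proof
  show "finite (parcs (cayley_graph G D))"
    using assms(1) by (auto intro: finite_subset [of _ "carrier G \<times> carrier G"])
  show "symmetric (with_proj (cayley_graph G D))"
    using inverse_closed_swap [OF assms(2)] by (auto simp: symmetric_def sym_def)
qed (use assms in auto)

text \<open>Two distinct elements of \<open>D\<close> represent their own quotient, so
  \<open>\<mu>\<close> is positive. Hence any two distinct vertices have a common neighbour and are
  joined by a path of length two.\<close>

lemma connected_cayley_graph_difference_set:
  assumes fin: "finite (carrier G)" and D: "difference_set G D v k \<mu>"
    and inv: "inverse_closed G D"
  shows "Digraph_Component.connected (with_proj (cayley_graph G D))"
proof -
  interpret pair_pseudo_graph "cayley_graph G D"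
    using fin inv by (rule pair_pseudo_graph_cayley_graph)
  have sub: "D \<subseteq> carrier G" and "card D > 1"
    using D by (auto simp: difference_set_def)
  then obtain c1 c2 where c: "c1 \<in> D" "c2 \<in> D" "c1 \<noteq> c2"
    by (metis One_nat_def card.empty card_le_Suc0_iff_eq card.infinite not_less not_less_zero)
  then have "c1 \<otimes> inv c2 \<in> carrier G" "c1 \<otimes> inv c2 \<noteq> \<one>"
    using sub by (auto simp: subset_iff) (metis inv_closed inv_equality inv_inv subsetD sub)
  moreover have "diff_count G D (c1 \<otimes> inv c2) \<noteq> 0"
  proof -
    have "finite {(d1, d2) \<in> D \<times> D. c1 \<otimes> inv c2 = d1 \<otimes> inv d2}"
      using finite_subset [OF sub fin] by (auto intro: finite_subset [of _ "D \<times> D"])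
    then show ?thesis
      using c by (auto simp: diff_count_def)
  qed
  ultimately have "\<mu> \<noteq> 0"
    using difference_set_diff_count [OF D] by metis
  have reach: "u \<rightarrow>\<^sup>*\<^bsub>with_proj (cayley_graph G D)\<^esub> w"
    if u: "u \<in> carrier G" and w: "w \<in> carrier G" for u w
  proof (cases "u = w")
    case True
    then show ?thesis
      using u by simp
  next
    case False
    then have "u \<otimes> inv w \<noteq> \<one>"
      using u w by (metis inv_closed inv_equality inv_inv)
    then have "card {x \<in> carrier G. u \<otimes> inv x \<in> D \<and> w \<otimes> inv x \<in> D} \<noteq> 0"
      using card_cayley_common_out_neighbours [OF sub u w] difference_set_diff_count [OF D]
        u w \<open>\<mu> \<noteq> 0\<close> by simp
    then obtain x where x: "x \<in> carrier G" "u \<otimes> inv x \<in> D" "w \<otimes> inv x \<in> D"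
      by (metis (mono_tags, lifting) card.empty empty_Collect_eq)
    have "(u, x) \<in> parcs (cayley_graph G D)" "(x, w) \<in> parcs (cayley_graph G D)"
      using x u w inverse_closed_swap [OF inv w x(1)] by auto
    then show ?thesis
      by (meson reachable_adjI reachable_trans)
  qed
  show ?thesis
    \<comment> \<open>Connectedness means strong connectedness of the symmetric closure, to which
      the reachability just shown carries over.\<close>
    unfolding Digraph_Component.connected_def
  proof (rule strongly_connectedI)
    show "verts (with_proj (mk_symmetric (with_proj (cayley_graph G D)))) \<noteq> {}"
      using one_closed by auto
    show "u \<rightarrow>\<^sup>*\<^bsub>with_proj (mk_symmetric (with_proj (cayley_graph G D)))\<^esub> w"
      if "u \<in> verts (with_proj (mk_symmetric (with_proj (cayley_graph G D))))"
        "w \<in> verts (with_proj (mk_symmetric (with_proj (cayley_graph G D))))" for u w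
      using that reach by (intro reachable_mk_symmetricI) simp
  qed
qed

lemma regular_cayley_graph:
  assumes "D \<subseteq> carrier G"
  shows "regular_graph (cayley_graph G D) (card D)"
  unfolding regular_graph_def
proof
  fix u assume "u \<in> pverts (cayley_graph G D)"
  then have u: "u \<in> carrier G"
    by simp
  have "out_arcs (with_proj (cayley_graph G D)) u = Pair u ` {w \<in> carrier G. u \<otimes> inv w \<in> D}"
    using u by (auto simp: out_arcs_def)
  then show "out_degree (with_proj (cayley_graph G D)) u = card D"
    using card_cayley_out_neighbours [OF assms u]
    by (simp add: out_degree_def card_image inj_on_def)
qed

lemma ramanujan_cayley_graph_difference_set:
  assumes fin: "finite (carrier G)" and D: "difference_set G D v k \<mu>"
    and inv: "inverse_closed G D"
  shows "ramanujan_graph (cayley_graph G D)"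
proof -
  have k: "card D = k" "k > 1" and sub: "D \<subseteq> carrier G"
    using D by (auto simp: difference_set_def)
  have "\<theta> \<le> 2 * sqrt (real k - 1)"
    if eig: "graph_eigenvalue (cayley_graph G D) \<theta>" and \<theta>: "\<bar>\<theta>\<bar> \<noteq> real k" for \<theta>
  proof (rule graph_eigenvalue_eigenfunction [OF eig, unfolded cayley_graph_simps(1)])
    fix u and f :: "'a \<Rightarrow> real"
    assume u: "u \<in> carrier G" "f u \<noteq> 0"
      and f: "\<And>x. x \<in> carrier G \<Longrightarrow>
        (\<Sum>w\<in>carrier G. (if (x, w) \<in> parcs (cayley_graph G D) then 1 else 0) * f w) = \<theta> * f x"
    have "\<theta>\<^sup>2 = real k - real \<mu>"
    proof (rule cayley_eigenfunction_square [where f = f and u = u, OF fin D inv])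
      show "(\<Sum>w\<in>carrier G. (if x \<otimes> inv w \<in> D then 1 else 0) * f w) = \<theta> * f x"
        if x: "x \<in> carrier G" for x
        using f [OF x] x by (simp cong: sum.cong)
    qed (use u \<theta> in auto)
    \<comment> \<open>Since \<open>k \<ge> 2\<close>, already
      \<open>k \<le> 4 * (k - 1)\<close>.\<close>
    also have "\<dots> \<le> 4 * (real k - 1)"
      using k by simp
    finally have "\<theta> \<le> sqrt (4 * (real k - 1))"
      by (rule real_le_rsqrt)
    then show "\<theta> \<le> 2 * sqrt (real k - 1)"
      unfolding real_sqrt_mult by simp
  qed
  then show ?thesis
    using pair_pseudo_graph_cayley_graph [OF fin inv]
      connected_cayley_graph_difference_set [OF fin D inv] regular_cayley_graph [OF sub] k(1)
    unfolding ramanujan_graph_def by blast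
qed

end

theorem corollary2p4:
  fixes G :: "('a, 'b) monoid_scheme" and C :: "'a set" and v k \<mu> :: nat
  assumes "comm_group G"
    and "finite (carrier G)"
    and "difference_set G C v k \<mu>"
    and "is_multiplier G C (- 1)"
  shows "\<exists>g \<in> carrier G. inverse_closed G (g <#\<^bsub>G\<^esub> C) \<and>
           ramanujan_graph (cayley_graph G (g <#\<^bsub>G\<^esub> C))"
proof -
  interpret comm_group G
    by fact
  show ?thesis
    using ex_inverse_closed_l_coset [OF assms(2-4)] difference_set_l_coset [OF assms(3)]
      ramanujan_cayley_graph_difference_set [OF assms(2)] by blast
qed

end
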